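(* Let $\mathbb{K}$ be a field. For all integers $n\ge 2$ and $d\ge 2$ there exists an $\mathfrak{m}$-primary monomial ideal $I\subset \mathbb{K}[x_1,\ldots,x_n]$, where $\mathfrak m=\langle x_1,\ldots,x_n\rangle$, such that $|G(I)|>|G(I^i)|$ for all integers $i$ with $2\le i\le d$.
   Context: For a monomial ideal $I$ in the polynomial ring $\mathbb{K}[x_1,\ldots,x_n]$, $G(I)$ denotes the unique minimal monomial generating set of $I$, and $|G(I)|$ its cardinality. $I^i$ denotes the $i$-th power of the ideal $I$. *)

theory Defs
  imports "HOL-Algebra.Ideal_Product" "HOL-Library.Poly_Mapping"
begin

text \<open>
  A polynomial is a finitely supported map from exponent vectors to coefficients, with the
  convolution product of \<^theory>\<open>HOL-Library.Poly_Mapping\<close>; the polynomial ring in the variables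
  $x_1, \dots, x_n$ is the subring of those polynomials in which no other variable occurs.
\<close>

type_synonym 'k mpoly = "(nat \<Rightarrow>\<^sub>0 nat) \<Rightarrow>\<^sub>0 'k"

definition poly_ring :: "nat \<Rightarrow> ('k::field mpoly) ring" where
  "poly_ring n =
     \<lparr>carrier = {p. \<forall>m \<in> Poly_Mapping.keys p. Poly_Mapping.keys m \<subseteq> {1..n}},
      mult = (*), one = 1, zero = 0, add = (+)\<rparr>"

definition monomial_of :: "(nat \<Rightarrow>\<^sub>0 nat) \<Rightarrow> 'k::field mpoly" where
  "monomial_of m = Poly_Mapping.single m 1"

definition monomials :: "nat \<Rightarrow> ('k::field mpoly) set" where
  "monomials n = {monomial_of m | m. Poly_Mapping.keys m \<subseteq> {1..n}}"

definition indet :: "nat \<Rightarrow> 'k::field mpoly" where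
  "indet i = monomial_of (Poly_Mapping.single i 1)"

definition irrelevant_ideal :: "nat \<Rightarrow> ('k::field mpoly) set" where
  "irrelevant_ideal n = Idl\<^bsub>poly_ring n\<^esub> (indet ` {1..n})"

definition monomial_ideal :: "nat \<Rightarrow> ('k::field mpoly) set \<Rightarrow> bool" where
  "monomial_ideal n I \<longleftrightarrow> (\<exists>S \<subseteq> monomials n. I = Idl\<^bsub>poly_ring n\<^esub> S)"

definition radical :: "('a, 'b) ring_scheme \<Rightarrow> 'a set \<Rightarrow> 'a set" where
  "radical R I = {a \<in> carrier R. \<exists>k::nat. a [^]\<^bsub>R\<^esub> k \<in> I}"

locale primaryideal = ideal + cring +
  assumes I_notcarr: "carrier R \<noteq> I"
    and I_primary: "\<lbrakk>a \<in> carrier R; b \<in> carrier R; a \<otimes> b \<in> I; a \<notin> I\<rbrakk>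
      \<Longrightarrow> \<exists>k::nat. b [^] k \<in> I"

definition primary_to :: "('a, 'b) ring_scheme \<Rightarrow> 'a set \<Rightarrow> 'a set \<Rightarrow> bool" where
  "primary_to R P I \<longleftrightarrow> primaryideal I R \<and> radical R I = P"

definition is_min_monomial_gens ::
    "nat \<Rightarrow> ('k::field mpoly) set \<Rightarrow> ('k mpoly) set \<Rightarrow> bool" where
  "is_min_monomial_gens n I S \<longleftrightarrow>
     S \<subseteq> monomials n \<and> Idl\<^bsub>poly_ring n\<^esub> S = I \<and> (\<forall>T. T \<subset> S \<longrightarrow> Idl\<^bsub>poly_ring n\<^esub> T \<noteq> I)"

text \<open>
  The set $G(I)$; the definite description is justified by \<open>ex1_min_monomial_gens\<close> below.
  It is always finite (Dickson's lemma), so \<^const>\<open>card\<close> measures its true size.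
\<close>

definition min_monomial_gens :: "nat \<Rightarrow> ('k::field mpoly) set \<Rightarrow> ('k mpoly) set" where
  "min_monomial_gens n I = (THE S. is_min_monomial_gens n I S)"

text \<open>The power $I^i$ is taken in the library's semiring of ideals under the ideal product.\<close>

definition ideal_power :: "('a, 'b) ring_scheme \<Rightarrow> 'a set \<Rightarrow> nat \<Rightarrow> 'a set" where
  "ideal_power R I i = I [^]\<^bsub>ideals_set R\<^esub> i"


lemma poly_ring_simps:
  "p \<in> carrier (poly_ring n) \<longleftrightarrow> (\<forall>m \<in> Poly_Mapping.keys p. Poly_Mapping.keys m \<subseteq> {1..n})"
  "mult (poly_ring n) = (*)" "one (poly_ring n) = 1"
  "zero (poly_ring n) = 0" "add (poly_ring n) = (+)"
  by (simp_all add: poly_ring_def)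

lemma keys_plus_exponent:
  fixes a b :: "nat \<Rightarrow>\<^sub>0 nat"
  shows "Poly_Mapping.keys (a + b) = Poly_Mapping.keys a \<union> Poly_Mapping.keys b"
  by (auto simp: in_keys_iff lookup_add)

lemma poly_ring_mult_closed:
  assumes "p \<in> carrier (poly_ring n)" "q \<in> carrier (poly_ring n)"
  shows "p * q \<in> carrier (poly_ring n)"
  unfolding poly_ring_simps
proof
  fix m assume "m \<in> Poly_Mapping.keys (p * q)"
  then obtain a b where "m = a + b" "a \<in> Poly_Mapping.keys p" "b \<in> Poly_Mapping.keys q"
    using keys_mult[of p q] by blast
  then show "Poly_Mapping.keys m \<subseteq> {1..n}"
    using assms by (auto simp: poly_ring_simps keys_plus_exponent)
qed

lemma poly_ring_add_closed:
  assumes "p \<in> carrier (poly_ring n)" "q \<in> carrier (poly_ring n)"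
  shows "p + q \<in> carrier (poly_ring n)"
  using assms Poly_Mapping.keys_add[of p q] unfolding poly_ring_simps by blast

lemma cring_poly_ring: "cring (poly_ring n)"
proof (rule cringI)
  show "abelian_group (poly_ring n)"
  proof (rule abelian_groupI)
    fix x assume "x \<in> carrier (poly_ring n)"
    then have "- x \<in> carrier (poly_ring n)" by (simp add: poly_ring_simps)
    then show "\<exists>y \<in> carrier (poly_ring n). y \<oplus>\<^bsub>poly_ring n\<^esub> x = \<zero>\<^bsub>poly_ring n\<^esub>"
      by (intro bexI[of _ "- x"]) (auto simp: poly_ring_simps(2-))
  qed (use poly_ring_add_closed in \<open>auto simp: poly_ring_simps(2-) ac_simps\<close>,
       simp add: poly_ring_simps)
next
  show "comm_monoid (poly_ring n)"
    by (rule comm_monoidI)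
      (use poly_ring_mult_closed in \<open>auto simp: poly_ring_simps(2-) ac_simps\<close>,
       simp add: poly_ring_simps)
qed (simp add: poly_ring_simps(2-) algebra_simps)

lemma ideal_genideal_poly_ring:
  assumes "S \<subseteq> carrier (poly_ring n)"
  shows "ideal (Idl\<^bsub>poly_ring n\<^esub> S) (poly_ring n)"
  using ring.genideal_ideal cring.axioms(1)[OF cring_poly_ring] assms by blast

lemma keys_monomial_of [simp]: "Poly_Mapping.keys (monomial_of m :: 'k::field mpoly) = {m}"
  by (simp add: monomial_of_def)

lemma monomial_of_add: "(monomial_of (a + b) :: 'k::field mpoly) = monomial_of a * monomial_of b"
  by (simp add: monomial_of_def mult_single)

lemma monomial_of_eq_iff [simp]: "(monomial_of a :: 'k::field mpoly) = monomial_of b \<longleftrightarrow> a = b"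
  by (metis keys_monomial_of singleton_inject)

lemma monomial_of_in_monomials [simp]:
  "(monomial_of m :: 'k::field mpoly) \<in> monomials n \<longleftrightarrow> Poly_Mapping.keys m \<subseteq> {1..n}"
  by (auto simp: monomials_def)

lemma monomials_subset_carrier: "monomials n \<subseteq> carrier (poly_ring n)"
  by (auto simp: monomials_def poly_ring_simps)

lemma keys_genideal_monomials:
  fixes p :: "'k::field mpoly"
  assumes S: "S \<subseteq> monomials n" and p: "p \<in> Idl\<^bsub>poly_ring n\<^esub> S"
    and m: "m \<in> Poly_Mapping.keys p"
  shows "\<exists>s u. monomial_of s \<in> S \<and> m = s + u"
proof -
  define D :: "'k mpoly set" where
    "D = {p \<in> carrier (poly_ring n).
            \<forall>m \<in> Poly_Mapping.keys p. \<exists>s u. monomial_of s \<in> S \<and> m = s + u}"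
  interpret cring "poly_ring n :: 'k mpoly ring" by (rule cring_poly_ring)
  have mult: "a * x \<in> D" if "a \<in> D" "x \<in> carrier (poly_ring n)" for a x
  proof -
    have "\<exists>s u. monomial_of s \<in> S \<and> m = s + u" if "m \<in> Poly_Mapping.keys (a * x)" for m
    proof -
      obtain b c where "m = b + c" "b \<in> Poly_Mapping.keys a"
        using keys_mult[of a x] \<open>m \<in> Poly_Mapping.keys (a * x)\<close> by blast
      moreover then obtain s u where "monomial_of s \<in> S" "b = s + u"
        using \<open>a \<in> D\<close> by (auto simp: D_def)
      ultimately show ?thesis by (metis add.assoc)
    qed
    then show ?thesis using that poly_ring_mult_closed by (auto simp: D_def)
  qed
  have inv: "\<ominus>\<^bsub>poly_ring n\<^esub> a = - a" if "a \<in> carrier (poly_ring n)" for a :: "'k mpoly"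
    by (rule minus_equality) (use that in \<open>auto simp: poly_ring_simps\<close>)
  have "ideal D (poly_ring n)"
  proof (rule idealI)
    show "subgroup D (add_monoid (poly_ring n))"
    proof
      fix a b assume "a \<in> D" "b \<in> D"
      then have "a + b \<in> D"
        using Poly_Mapping.keys_add[of a b] poly_ring_add_closed[of a n b]
        unfolding D_def by blast
      then show "a \<otimes>\<^bsub>add_monoid (poly_ring n)\<^esub> b \<in> D" by (simp add: poly_ring_simps)
    next
      fix a assume "a \<in> D"
      then have "- a \<in> D" by (auto simp: D_def poly_ring_simps)
      then show "inv\<^bsub>add_monoid (poly_ring n)\<^esub> a \<in> D"
        using inv[of a] \<open>a \<in> D\<close> by (auto simp: D_def a_inv_def)
    qed (auto simp: D_def poly_ring_simps)
  qed (use mult ring_axioms in \<open>auto simp: poly_ring_simps(2) mult.commute\<close>)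
  moreover have "S \<subseteq> D"
  proof
    fix x assume "x \<in> S"
    moreover from this obtain s where "x = monomial_of s"
      using S by (auto simp: monomials_def)
    moreover have "s = s + 0" by simp
    ultimately show "x \<in> D" using S monomials_subset_carrier[of n] by (force simp: D_def)
  qed
  ultimately have "Idl\<^bsub>poly_ring n\<^esub> S \<subseteq> D" by (rule genideal_minimal)
  then show ?thesis using p m by (auto simp: D_def)
qed

lemma monomial_of_in_genideal_iff:
  fixes S :: "('k::field mpoly) set"
  assumes S: "S \<subseteq> monomials n" and m: "Poly_Mapping.keys m \<subseteq> {1..n}"
  shows "monomial_of m \<in> Idl\<^bsub>poly_ring n\<^esub> S \<longleftrightarrow> (\<exists>s u. monomial_of s \<in> S \<and> m = s + u)"
proof
  assume "monomial_of m \<in> Idl\<^bsub>poly_ring n\<^esub> S"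
  then show "\<exists>s u. monomial_of s \<in> S \<and> m = s + u"
    by (rule keys_genideal_monomials[OF S]) simp
next
  assume "\<exists>s u. monomial_of s \<in> S \<and> m = s + u"
  then obtain s u where su: "monomial_of s \<in> S" "m = s + u" by blast
  have SC: "S \<subseteq> carrier (poly_ring n)" using S monomials_subset_carrier by blast
  have "monomial_of s \<in> Idl\<^bsub>poly_ring n\<^esub> S"
    using ring.genideal_self[OF cring.axioms(1)[OF cring_poly_ring] SC] su by blast
  moreover have "(monomial_of u :: 'k mpoly) \<in> carrier (poly_ring n)"
    using m su by (simp add: poly_ring_simps keys_plus_exponent)
  ultimately have "monomial_of s * monomial_of u \<in> Idl\<^bsub>poly_ring n\<^esub> S"
    using ideal.I_r_closed[OF ideal_genideal_poly_ring[OF SC]] by (simp add: poly_ring_simps(2))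
  then show "monomial_of m \<in> Idl\<^bsub>poly_ring n\<^esub> S" using su by (simp add: monomial_of_add)
qed

lemma genideal_eqI:
  fixes S T :: "('k::field mpoly) set"
  assumes "S \<subseteq> monomials n" "T \<subseteq> Idl\<^bsub>poly_ring n\<^esub> S" "S \<subseteq> Idl\<^bsub>poly_ring n\<^esub> T" "T \<subseteq> monomials n"
  shows "Idl\<^bsub>poly_ring n\<^esub> S = Idl\<^bsub>poly_ring n\<^esub> T"
proof -
  have C: "S \<subseteq> carrier (poly_ring n)" "T \<subseteq> carrier (poly_ring n)"
    using assms monomials_subset_carrier by blast+
  show ?thesis
    using ring.genideal_minimal[OF cring.axioms(1)[OF cring_poly_ring]
        ideal_genideal_poly_ring[OF C(1)] assms(2)]
      ring.genideal_minimal[OF cring.axioms(1)[OF cring_poly_ring]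
        ideal_genideal_poly_ring[OF C(2)] assms(3)]
    by blast
qed

lemma min_monomial_gens_subset:
  fixes S T :: "('k::field mpoly) set"
  assumes S: "is_min_monomial_gens n I S" and T: "is_min_monomial_gens n I T"
  shows "S \<subseteq> T"
proof
  fix x assume x: "x \<in> S"
  from S T have SM: "S \<subseteq> monomials n" and TM: "T \<subseteq> monomials n"
    and SI: "Idl\<^bsub>poly_ring n\<^esub> S = I" and TI: "Idl\<^bsub>poly_ring n\<^esub> T = I"
    by (auto simp: is_min_monomial_gens_def)
  have self: "U \<subseteq> Idl\<^bsub>poly_ring n\<^esub> U" if "U \<subseteq> monomials n" for U :: "('k mpoly) set"
    using ring.genideal_self[OF cring.axioms(1)[OF cring_poly_ring]]
      that monomials_subset_carrier by blast
  obtain s where s: "x = monomial_of s" "Poly_Mapping.keys s \<subseteq> {1..n}"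
    using x SM by (auto simp: monomials_def)
  have "monomial_of s \<in> Idl\<^bsub>poly_ring n\<^esub> T" using self[OF SM] x s SI TI by auto
  then obtain t u where t: "monomial_of t \<in> T" "s = t + u"
    using monomial_of_in_genideal_iff[OF TM s(2)] by blast
  have tk: "Poly_Mapping.keys t \<subseteq> {1..n}" using t s by (simp add: keys_plus_exponent)
  have "monomial_of t \<in> Idl\<^bsub>poly_ring n\<^esub> S" using self[OF TM] t SI TI by auto
  then obtain s' v where s': "monomial_of s' \<in> S" "t = s' + v"
    using monomial_of_in_genideal_iff[OF SM tk] by blast
  have "s' = s"
  proof (rule ccontr)
    assume "s' \<noteq> s"
    let ?U = "S - {x}"
    have UM: "?U \<subseteq> monomials n" using SM by blast
    have "monomial_of s' \<in> ?U" "s = s' + (v + u)"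
      using s' s t \<open>s' \<noteq> s\<close> by (auto simp: add.assoc)
    then have "x \<in> Idl\<^bsub>poly_ring n\<^esub> ?U"
      using monomial_of_in_genideal_iff[OF UM s(2)] s by blast
    then have "Idl\<^bsub>poly_ring n\<^esub> ?U = Idl\<^bsub>poly_ring n\<^esub> S"
      using self[OF UM] self[OF SM] UM SM by (intro genideal_eqI) auto
    then show False using S x SI by (auto simp: is_min_monomial_gens_def)
  qed
  then have "s + (v + u) = s + 0" using s' t by (simp add: add.assoc)
  then have "v + u = 0" by simp
  then have "Poly_Mapping.keys u = {}" using keys_plus_exponent[of v u] by simp
  then have "u = 0" by simp
  then show "x \<in> T" using t s by simp
qed

lemma ex1_min_monomial_gens:
  fixes I :: "('k::field mpoly) set"
  assumes "monomial_ideal n I"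
  shows "\<exists>!S. is_min_monomial_gens n I S"
proof (rule ex_ex1I)
  obtain B where BM: "B \<subseteq> monomials n" and BI: "I = Idl\<^bsub>poly_ring n\<^esub> B"
    using assms by (auto simp: monomial_ideal_def)
  define S where "S = {x \<in> B. \<forall>s t u. x = monomial_of s \<longrightarrow> monomial_of t \<in> B \<longrightarrow> s = t + u \<longrightarrow> u = 0}"
  have SM: "S \<subseteq> monomials n" and SB: "S \<subseteq> B" using BM by (auto simp: S_def)
  have self: "U \<subseteq> Idl\<^bsub>poly_ring n\<^esub> U" if "U \<subseteq> monomials n" for U :: "('k mpoly) set"
    using ring.genideal_self[OF cring.axioms(1)[OF cring_poly_ring]]
      that monomials_subset_carrier by blast
  have div: "\<exists>s u. monomial_of s \<in> S \<and> m = s + u"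
    if "(monomial_of m :: 'k mpoly) \<in> B" for m
    using that
  proof (induction "sum (Poly_Mapping.lookup m) {1..n}" arbitrary: m rule: less_induct)
    case less
    show ?case
    proof (cases "monomial_of m \<in> S")
      case True
      then show ?thesis by (metis add.right_neutral)
    next
      case False
      then obtain t u where t: "monomial_of t \<in> B" "m = t + u" "u \<noteq> 0"
        using less.prems by (auto simp: S_def)
      have "Poly_Mapping.keys m \<subseteq> {1..n}"
        using less.prems BM by (meson monomial_of_in_monomials subsetD)
      then have "Poly_Mapping.keys u \<subseteq> {1..n}" using t by (simp add: keys_plus_exponent)
      moreover obtain i where "i \<in> Poly_Mapping.keys u" using \<open>u \<noteq> 0\<close> by fastforce
      ultimately have "i \<in> {1..n}" "0 < Poly_Mapping.lookup u i"
        by (blast, simp add: in_keys_iff)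
      then have "0 < sum (Poly_Mapping.lookup u) {1..n}"
        by (intro sum_pos2[of _ i]) auto
      then have "sum (Poly_Mapping.lookup t) {1..n} < sum (Poly_Mapping.lookup m) {1..n}"
        using t by (simp add: lookup_add sum.distrib)
      from less.hyps[OF this t(1)] show ?thesis using t(2) by (metis add.assoc)
    qed
  qed
  have "B \<subseteq> Idl\<^bsub>poly_ring n\<^esub> S"
  proof
    fix x assume "x \<in> B"
    moreover from this obtain m where "x = monomial_of m" "Poly_Mapping.keys m \<subseteq> {1..n}"
      using BM by (auto simp: monomials_def)
    ultimately show "x \<in> Idl\<^bsub>poly_ring n\<^esub> S"
      using div monomial_of_in_genideal_iff[OF SM] by blast
  qed
  then have SI: "Idl\<^bsub>poly_ring n\<^esub> S = I"
    unfolding BI using SM BM SB self[OF BM] by (intro genideal_eqI) auto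
  have "Idl\<^bsub>poly_ring n\<^esub> T \<noteq> I" if "T \<subset> S" for T
  proof
    assume TI: "Idl\<^bsub>poly_ring n\<^esub> T = I"
    obtain x where x: "x \<in> S" "x \<notin> T" using \<open>T \<subset> S\<close> by blast
    obtain m where m: "x = monomial_of m" "Poly_Mapping.keys m \<subseteq> {1..n}"
      using x SM by (auto simp: monomials_def)
    have TM: "T \<subseteq> monomials n" using \<open>T \<subset> S\<close> SM by blast
    have "monomial_of m \<in> Idl\<^bsub>poly_ring n\<^esub> T" using self[OF SM] x m SI TI by auto
    then obtain t u where t: "monomial_of t \<in> T" "m = t + u"
      using monomial_of_in_genideal_iff[OF TM m(2)] by blast
    moreover have "monomial_of t \<in> B" using t \<open>T \<subset> S\<close> SB by blast
    ultimately have "u = 0" using x(1) m(1) by (auto simp: S_def)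
    then show False using t m x by simp
  qed
  then show "\<exists>S. is_min_monomial_gens n I S"
    using SM SI by (auto simp: is_min_monomial_gens_def)
qed (use min_monomial_gens_subset in blast)

end

(* Let J be an m-primary ideal with few generators, and p a monomial outside J such that
   pJ and p^2 lie in J^2. For n = 2 one can take J = (x^4, x^3 y, x y^3, y^4) and p = x^2 y^2, and
   for each further variable z one adds z^4, x^2 z^2 and y^2 z^2 to J. Replace every exponent by
   its k-fold multiple. Then p times any monomial of degree k - 1 in x and y is still outside J, so
   adding to J these k multiples of p, which form an antichain, gives an ideal I with at least k
   minimal generators. But IJ = I^2 = J^2, hence I^i = J^i for all i >= 2, and the number of
   generators of J^i is bounded independently of k. *)

theory Submission
  imports Defs "HOL-Library.Set_Algebras"
begin

section \<open>Monomial ideals described by sets of exponent vectors\<close>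

definition monomial_span :: "nat \<Rightarrow> (nat \<Rightarrow>\<^sub>0 nat) set \<Rightarrow> ('k::field mpoly) set" where
  "monomial_span n E = Idl\<^bsub>poly_ring n\<^esub> (monomial_of ` E)"

definition exponents :: "nat \<Rightarrow> (nat \<Rightarrow>\<^sub>0 nat) set" where
  "exponents n = {m. Poly_Mapping.keys m \<subseteq> {1..n}}"

lemma exponents_plus_iff: "a + b \<in> exponents n \<longleftrightarrow> a \<in> exponents n \<and> b \<in> exponents n"
  by (auto simp: exponents_def keys_plus_exponent)

lemma set_plus_exponents: "E \<subseteq> exponents n \<Longrightarrow> F \<subseteq> exponents n \<Longrightarrow> E + F \<subseteq> exponents n"
  by (auto simp: set_plus_def exponents_plus_iff)

lemma monomial_of_image_monomials_iff:
  "(monomial_of ` E :: ('k::field mpoly) set) \<subseteq> monomials n \<longleftrightarrow> E \<subseteq> exponents n"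
  unfolding image_subset_iff exponents_def by auto

lemma exponent_dvd_iff:
  fixes s m :: "nat \<Rightarrow>\<^sub>0 nat"
  shows "(\<exists>u. m = s + u) \<longleftrightarrow> (\<forall>i. Poly_Mapping.lookup s i \<le> Poly_Mapping.lookup m i)"
proof
  assume "\<forall>i. Poly_Mapping.lookup s i \<le> Poly_Mapping.lookup m i"
  then have "m = s + (m - s)"
    by (intro poly_mapping_eqI) (simp add: lookup_add lookup_minus)
  then show "\<exists>u. m = s + u" by blast
qed (auto simp: lookup_add)

lemma ideal_monomial_span:
  "E \<subseteq> exponents n \<Longrightarrow> ideal (monomial_span n E :: ('k::field mpoly) set) (poly_ring n)"
  unfolding monomial_span_def
  by (rule ideal_genideal_poly_ring)
    (use monomial_of_image_monomials_iff monomials_subset_carrier in blast)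

lemma monomial_ideal_monomial_span:
  "E \<subseteq> exponents n \<Longrightarrow> monomial_ideal n (monomial_span n E :: ('k::field mpoly) set)"
  unfolding monomial_span_def monomial_ideal_def using monomial_of_image_monomials_iff by blast

lemma monomial_of_in_monomial_span_iff:
  assumes "E \<subseteq> exponents n" "m \<in> exponents n"
  shows "(monomial_of m :: 'k::field mpoly) \<in> monomial_span n E \<longleftrightarrow> (\<exists>s\<in>E. \<exists>u. m = s + u)"
  using assms monomial_of_in_genideal_iff[of "monomial_of ` E :: 'k mpoly set" n m]
  unfolding monomial_span_def monomial_of_image_monomials_iff
  by (auto simp: exponents_def image_iff)

lemma single_mult_monomial_of:
  "Poly_Mapping.single 0 c * monomial_of m = Poly_Mapping.single m (c :: 'k::field)"
  by (simp add: monomial_of_def mult_single)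

text \<open>A polynomial is the finite sum of its terms, and each term is a scalar multiple of a
  monomial that some generator divides. Membership thus becomes a divisibility test on single
  exponents, which all later ideal computations use.\<close>

lemma in_monomial_span_iff:
  fixes p :: "'k::field mpoly"
  assumes E: "E \<subseteq> exponents n"
  shows "p \<in> monomial_span n E \<longleftrightarrow>
    p \<in> carrier (poly_ring n) \<and> (\<forall>m \<in> Poly_Mapping.keys p. \<exists>s\<in>E. \<exists>u. m = s + u)"
proof
  assume p: "p \<in> monomial_span n E"
  have "p \<in> carrier (poly_ring n)"
    using ideal.Icarr[OF ideal_monomial_span[OF E] p] .
  moreover have "\<exists>s\<in>E. \<exists>u. m = s + u" if "m \<in> Poly_Mapping.keys p" for m
    using keys_genideal_monomials[of "monomial_of ` E" n p m] E p that
    unfolding monomial_span_def monomial_of_image_monomials_iff by auto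
  ultimately show "p \<in> carrier (poly_ring n) \<and> (\<forall>m \<in> Poly_Mapping.keys p. \<exists>s\<in>E. \<exists>u. m = s + u)"
    by blast
next
  interpret ideal "monomial_span n E :: 'k mpoly set" "poly_ring n"
    by (rule ideal_monomial_span[OF E])
  assume p: "p \<in> carrier (poly_ring n) \<and> (\<forall>m \<in> Poly_Mapping.keys p. \<exists>s\<in>E. \<exists>u. m = s + u)"
  have summand: "Poly_Mapping.single m c \<in> monomial_span n E" if "m \<in> Poly_Mapping.keys p"
    for m and c :: 'k
  proof -
    have "m \<in> exponents n" using p that by (auto simp: poly_ring_simps exponents_def)
    then have "monomial_of m \<in> monomial_span n E"
      using p that by (subst monomial_of_in_monomial_span_iff[OF E]) auto
    moreover have "(Poly_Mapping.single 0 c :: 'k mpoly) \<in> carrier (poly_ring n)"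
      by (simp add: poly_ring_simps)
    ultimately have "Poly_Mapping.single 0 c * monomial_of m \<in> monomial_span n E"
      using I_l_closed by (fastforce simp: poly_ring_simps(2))
    then show ?thesis by (simp only: single_mult_monomial_of)
  qed
  have zero: "(0 :: 'k mpoly) \<in> monomial_span n E"
    using additive_subgroup.zero_closed[OF is_additive_subgroup] by (simp add: poly_ring_simps(4))
  have add: "a + b \<in> monomial_span n E"
    if "a \<in> monomial_span n E" "b \<in> monomial_span n E" for a b :: "'k mpoly"
    using additive_subgroup.a_closed[OF is_additive_subgroup that] by (simp add: poly_ring_simps(5))
  \<comment> \<open>Stated for arbitrary finite \<open>K\<close> inside the support so that
    induction can add one term at a time; \<open>K\<close> is then the whole support.\<close>
  have "(\<Sum>m\<in>K. Poly_Mapping.single m (Poly_Mapping.lookup p m)) \<in> monomial_span n E"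
    if "finite K" "K \<subseteq> Poly_Mapping.keys p" for K
    using that by (induction K rule: finite_induct) (auto simp: zero intro!: add summand)
  moreover have "(\<Sum>m\<in>Poly_Mapping.keys p. Poly_Mapping.single m (Poly_Mapping.lookup p m)) = p"
    by (intro poly_mapping_eqI) (auto simp: lookup_sum lookup_single when_def in_keys_iff)
  ultimately show "p \<in> monomial_span n E" by (metis finite_keys order_refl)
qed

lemma monomial_span_mono:
  assumes "E \<subseteq> exponents n" "F \<subseteq> exponents n" and le: "\<And>m. m \<in> E \<Longrightarrow> \<exists>s\<in>F. \<exists>u. m = s + u"
  shows "(monomial_span n E :: ('k::field mpoly) set) \<subseteq> monomial_span n F"
proof
  fix p :: "'k mpoly"
  assume "p \<in> monomial_span n E"
  then show "p \<in> monomial_span n F"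
    using assms(1,2) by (simp add: in_monomial_span_iff) (metis le add.assoc)
qed

section \<open>Products and powers as sumsets of exponents\<close>

text \<open>A key of \<open>p * q\<close> is a sum of a key of \<open>p\<close> and a key of
  \<open>q\<close>, hence divisible by a product of generators. Conversely each generator on the
  right is itself a product of one generator from either factor.\<close>

lemma ideal_prod_monomial_span:
  assumes E: "E \<subseteq> exponents n" and F: "F \<subseteq> exponents n"
  shows "ideal_prod (poly_ring n) (monomial_span n E) (monomial_span n F)
    = (monomial_span n (E + F) :: ('k::field mpoly) set)" (is "?P = ?Q")
proof
  note EF = set_plus_exponents[OF E F]
  interpret Q: ideal ?Q "poly_ring n" by (rule ideal_monomial_span[OF EF])
  show "?P \<subseteq> ?Q"
  proof
    fix x assume "x \<in> ?P"
    then show "x \<in> ?Q"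
    proof (induction rule: ideal_prod.induct)
      case (prod p q)
      then have "p * q \<in> carrier (poly_ring n)"
        by (intro poly_ring_mult_closed) (auto simp: in_monomial_span_iff E F)
      moreover have "\<exists>s\<in>E + F. \<exists>u. m = s + u" if m: "m \<in> Poly_Mapping.keys (p * q)" for m
      proof -
        obtain a b where ab: "m = a + b" "a \<in> Poly_Mapping.keys p" "b \<in> Poly_Mapping.keys q"
          using m keys_mult[of p q] by blast
        then obtain s u t v where "s \<in> E" "t \<in> F" "a = s + u" "b = t + v"
          using prod by (auto simp: in_monomial_span_iff E F) metis
        then have "m = (s + t) + (u + v)" "s + t \<in> E + F"
          using ab by (auto simp: ac_simps)
        then show ?thesis by blast
      qed
      ultimately show ?case
        by (simp add: poly_ring_simps(2) in_monomial_span_iff[OF EF])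
    qed (rule additive_subgroup.a_closed[OF Q.is_additive_subgroup])
  qed
  interpret P: ideal ?P "poly_ring n"
    by (rule ring.ideal_prod_is_ideal[OF cring.axioms(1)[OF cring_poly_ring]])
      (rule ideal_monomial_span E F)+
  have mem: "monomial_of s \<in> (monomial_span n G :: 'k mpoly set)" if "G \<subseteq> exponents n" "s \<in> G" for s G
    using that by (subst monomial_of_in_monomial_span_iff) (auto intro: exI[of _ 0] bexI[of _ s])
  have "monomial_of ` (E + F) \<subseteq> ?P"
    using ideal_prod.prod[of _ "monomial_span n E" _ "monomial_span n F" "poly_ring n",
        OF mem[OF E] mem[OF F]]
    by (auto simp: set_plus_def monomial_of_add poly_ring_simps(2))
  then show "?Q \<subseteq> ?P"
    using ring.genideal_minimal[OF cring.axioms(1)[OF cring_poly_ring] P.ideal_axioms] by (subst monomial_span_def)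
qed

lemma monomial_span_zero: "monomial_span n {0} = (carrier (poly_ring n) :: ('k::field mpoly) set)"
proof -
  have "{0} \<subseteq> exponents n" by (simp add: exponents_def)
  then show ?thesis by (auto simp: in_monomial_span_iff)
qed

text \<open>Here \<open>((+) E ^^ i) {0}\<close> is the \<open>i\<close>-fold sumset of
  \<open>E\<close>. The inclusion in \<open>exponents n\<close> is carried along because the product
  rule needs it at each induction step.\<close>

lemma ideal_power_monomial_span:
  assumes E: "E \<subseteq> exponents n"
  shows "((+) E ^^ i) {0} \<subseteq> exponents n \<and>
    ideal_power (poly_ring n) (monomial_span n E) i
      = (monomial_span n (((+) E ^^ i) {0}) :: ('k::field mpoly) set)"
proof (induction i)
  case 0
  then show ?case
    by (simp add: ideal_power_def ideals_set_def nat_pow_def monomial_span_zero)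
      (simp add: exponents_def)
next
  case (Suc i)
  then show ?case
    using E ideal_prod_monomial_span[of "((+) E ^^ i) {0}" n E]
    by (simp add: ideal_power_def ideals_set_def nat_pow_def set_plus_exponents
      add.commute[of "((+) E ^^ i) {0}" E])
qed

lemma card_set_plus_le:
  assumes "finite E" "finite F"
  shows "card (E + F) \<le> card E * card F"
  using assms card_image_le[of "E \<times> F" "\<lambda>(a, b). a + b"]
  by (simp add: set_plus_image)

text \<open>Yields the crude bound on the generators of a power, depending only on the number of
  generators and not on their exponents.\<close>

lemma finite_card_iterated_set_plus:
  assumes "finite (E :: 'a::comm_monoid_add set)"
  shows "finite (((+) E ^^ i) {0}) \<and> card (((+) E ^^ i) {0}) \<le> card E ^ i"
proof (induction i)
  case (Suc i)
  then have "card (E + ((+) E ^^ i) {0}) \<le> card E * card (((+) E ^^ i) {0})"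
    using assms card_set_plus_le by blast
  also have "\<dots> \<le> card E * card E ^ i" using Suc by simp
  finally show ?case using Suc assms by (simp add: finite_set_plus)
qed simp

section \<open>The minimal generating set\<close>

text \<open>Replaces the definite description by the divisibility-minimal elements of any generating
  set. With \<open>D\<close> the exponents of the minimal generators, every element of
  \<open>D\<close> has a divisor in \<open>E\<close> and vice versa, and \<open>D\<close> is an
  antichain; this forces \<open>D\<close> to be the minimal part of \<open>E\<close>.\<close>

lemma min_monomial_gens_monomial_span:
  assumes E: "E \<subseteq> exponents n"
  shows "min_monomial_gens n (monomial_span n E :: ('k::field mpoly) set)
    = monomial_of ` {m \<in> E. \<forall>s\<in>E. \<forall>u. m = s + u \<longrightarrow> u = 0}"
proof -
  let ?I = "monomial_span n E :: 'k mpoly set"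
  have "is_min_monomial_gens n ?I (min_monomial_gens n ?I)"
    using theI'[OF ex1_min_monomial_gens[OF monomial_ideal_monomial_span[OF E]]]
    unfolding min_monomial_gens_def .
  moreover from this obtain D where D: "min_monomial_gens n ?I = monomial_of ` D" "D \<subseteq> exponents n"
  proof -
    have "monomials n = (monomial_of ` exponents n :: 'k mpoly set)"
      by (auto simp: monomials_def exponents_def)
    then show ?thesis
      using \<open>is_min_monomial_gens n ?I (min_monomial_gens n ?I)\<close> that
      unfolding is_min_monomial_gens_def by (metis subset_imageE)
  qed
  ultimately have span: "(monomial_span n D :: 'k mpoly set) = ?I"
    and min: "\<And>C. C \<subset> D \<Longrightarrow> (monomial_span n C :: 'k mpoly set) \<noteq> ?I"
    unfolding is_min_monomial_gens_def monomial_span_def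
    by (auto simp: image_strict_mono inj_on_def)
  have DE: "\<exists>s\<in>E. \<exists>u. m = s + u" if "m \<in> D" for m
  proof -
    have "monomial_of m \<in> (monomial_span n D :: 'k mpoly set)"
      using that D by (subst monomial_of_in_monomial_span_iff) (auto intro: exI[of _ 0] bexI[of _ m])
    then show ?thesis
      unfolding span using that D E by (subst (asm) monomial_of_in_monomial_span_iff) auto
  qed
  have ED: "\<exists>s\<in>D. \<exists>u. m = s + u" if "m \<in> E" for m
  proof -
    have "monomial_of m \<in> ?I"
      using that E by (subst monomial_of_in_monomial_span_iff) (auto intro: exI[of _ 0] bexI[of _ m])
    then show ?thesis
      unfolding span[symmetric] using that D E
      by (subst (asm) monomial_of_in_monomial_span_iff) auto
  qed
  have zero: "a = 0" if "a + b = 0" for a b :: "nat \<Rightarrow>\<^sub>0 nat"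
    using that keys_plus_exponent[of a b] by simp
  \<comment> \<open>If \<open>t\<close> properly divided \<open>s\<close>, dropping \<open>s\<close>
    would not change the ideal, contrary to the minimality of \<open>D\<close>.\<close>
  have antichain: "u = 0" if "s \<in> D" "t \<in> D" "s = t + u" for s t u
  proof (rule ccontr)
    assume "u \<noteq> 0"
    then have t: "t \<in> D - {s}" using that by auto
    have "\<exists>r\<in>D - {s}. \<exists>v. m = r + v" if "m \<in> D" for m
    proof (cases "m = s")
      case True
      then show ?thesis using t \<open>s = t + u\<close> by blast
    next
      case False
      then show ?thesis using that by (intro bexI[of _ m] exI[of _ 0]) auto
    qed
    then have "(monomial_span n D :: 'k mpoly set) \<subseteq> monomial_span n (D - {s})"
      using D by (intro monomial_span_mono) auto
    moreover have "(monomial_span n (D - {s}) :: 'k mpoly set) \<subseteq> monomial_span n D"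
      using D by (intro monomial_span_mono) (auto intro!: bexI exI[of _ 0])
    ultimately show False using min[of "D - {s}"] span that by auto
  qed
  have "D = {m \<in> E. \<forall>s\<in>E. \<forall>u. m = s + u \<longrightarrow> u = 0}"
  proof (intro equalityI subsetI)
    fix m assume m: "m \<in> D"
    have min: "u = 0" if "s \<in> E" "m = s + u" for s u
    proof -
      obtain t v where "t \<in> D" "s = t + v" using ED[OF \<open>s \<in> E\<close>] by blast
      then have "u + v = 0" using antichain[OF m, of t "u + v"] that by (simp add: ac_simps)
      then show ?thesis by (rule zero)
    qed
    obtain s u where "s \<in> E" "m = s + u" using DE[OF m] by blast
    with min have "m \<in> E" by (metis add.right_neutral)
    with min show "m \<in> {m \<in> E. \<forall>s\<in>E. \<forall>u. m = s + u \<longrightarrow> u = 0}" by blast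
  next
    fix m assume m: "m \<in> {m \<in> E. \<forall>s\<in>E. \<forall>u. m = s + u \<longrightarrow> u = 0}"
    then obtain t u where t: "t \<in> D" "m = t + u" using ED by blast
    obtain s v where "s \<in> E" "t = s + v" using DE[OF t(1)] by blast
    then have "u + v = 0" using m t by (simp add: ac_simps)
    then have "u = 0" by (rule zero)
    then show "m \<in> D" using t by simp
  qed
  then show ?thesis using D by simp
qed

section \<open>Ideals primary to the irrelevant ideal\<close>

lemma nat_pow_poly_ring: "p [^]\<^bsub>poly_ring n\<^esub> (k::nat) = (p::'k::field mpoly) ^ k"
  by (induction k) (simp_all add: nat_pow_def poly_ring_simps power_Suc2 del: power_Suc)

lemma poly_ring_power_closed:
  fixes p :: "'k::field mpoly"
  shows "p \<in> carrier (poly_ring n) \<Longrightarrow> p ^ k \<in> carrier (poly_ring n)"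
  by (induction k) (simp add: poly_ring_simps, simp add: poly_ring_mult_closed)

lemma exponent_plus_eq_0_iff: "0 = (a :: nat \<Rightarrow>\<^sub>0 nat) + b \<longleftrightarrow> a = 0 \<and> b = 0"
  by (metis add.right_neutral keys_eq_empty keys_plus_exponent sup_eq_bot_iff)

text \<open>Exponents are natural numbers, so \<open>0 = l + r\<close> only for
  \<open>l = r = 0\<close>: one summand of the convolution survives.\<close>

lemma lookup_mult_0:
  fixes p q :: "'k::field mpoly"
  shows "Poly_Mapping.lookup (p * q) 0 = Poly_Mapping.lookup p 0 * Poly_Mapping.lookup q 0"
proof -
  have "Poly_Mapping.lookup (p * q) 0 =
    (\<Sum>l. Poly_Mapping.lookup p l * (\<Sum>r. Poly_Mapping.lookup q r when 0 = l + r))"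
    by (simp add: lookup_mult)
  also have "\<dots> = (\<Sum>l. Poly_Mapping.lookup p l * Poly_Mapping.lookup q 0 when l = 0)"
    by (rule Sum_any.cong)
      (auto simp: exponent_plus_eq_0_iff when_def[of _ "_ \<and> _"] when_def[of _ "_ = _"]
      Sum_any_when_equal[unfolded when_def])
  finally show ?thesis by simp
qed

lemma lookup_power_0:
  "Poly_Mapping.lookup (p ^ k) 0 = Poly_Mapping.lookup (p :: 'k::field mpoly) 0 ^ k"
  by (induction k) (auto simp: lookup_mult_0 lookup_one)

text \<open>An exponent in \<open>n\<close> variables is divisible by some variable exactly when it
  is nonzero, so only the constant term is an obstruction.\<close>

lemma irrelevant_ideal_iff:
  "(p :: 'k::field mpoly) \<in> irrelevant_ideal n \<longleftrightarrow>
    p \<in> carrier (poly_ring n) \<and> Poly_Mapping.lookup p 0 = 0"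
proof -
  let ?E = "(\<lambda>j. Poly_Mapping.single j 1) ` {1..n} :: (nat \<Rightarrow>\<^sub>0 nat) set"
  have E: "?E \<subseteq> exponents n" by (auto simp: exponents_def)
  have dvd: "(\<exists>s\<in>?E. \<exists>u. m = s + u) \<longleftrightarrow> m \<noteq> 0" if "Poly_Mapping.keys m \<subseteq> {1..n}" for m
  proof
    assume "m \<noteq> 0"
    then obtain j where "j \<in> Poly_Mapping.keys m" by fastforce
    then have "j \<in> {1..n}" "\<exists>u. m = Poly_Mapping.single j 1 + u"
      using that by (blast, simp add: exponent_dvd_iff lookup_single when_def in_keys_iff)
    then show "\<exists>s\<in>?E. \<exists>u. m = s + u" by blast
  next
    assume "\<exists>s\<in>?E. \<exists>u. m = s + u"
    then obtain j u where "m = Poly_Mapping.single j 1 + u" by blast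
    then have "Poly_Mapping.lookup m j \<noteq> 0" by (simp add: lookup_add)
    then show "m \<noteq> 0" by auto
  qed
  have dvd_keys: "(\<exists>s\<in>?E. \<exists>u. m = s + u) \<longleftrightarrow> m \<noteq> 0"
    if "p \<in> carrier (poly_ring n)" "m \<in> Poly_Mapping.keys p" for m
    by (rule dvd) (use that in \<open>simp only: poly_ring_simps(1)\<close>)
  have irrelevant: "irrelevant_ideal n = (monomial_span n ?E :: 'k mpoly set)"
    unfolding irrelevant_ideal_def monomial_span_def indet_def image_image ..
  have const: "Poly_Mapping.lookup p 0 = 0 \<longleftrightarrow> (\<forall>m \<in> Poly_Mapping.keys p. m \<noteq> 0)"
    by (metis in_keys_iff)
  show ?thesis
    unfolding irrelevant in_monomial_span_iff[OF E] const
    by (intro conj_cong ball_cong refl dvd_keys)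
qed

text \<open>No key of \<open>p\<close> is 0, so each factor contributes at least 1 to the total
  degree.\<close>

lemma degree_keys_power:
  fixes p :: "'k::field mpoly"
  assumes "p \<in> irrelevant_ideal n" "m \<in> Poly_Mapping.keys (p ^ k)"
  shows "k \<le> sum (Poly_Mapping.lookup m) {1..n}"
  using assms(2)
proof (induction k arbitrary: m)
  case (Suc k)
  then obtain a b where ab: "m = a + b" "a \<in> Poly_Mapping.keys p" "b \<in> Poly_Mapping.keys (p ^ k)"
    using keys_mult[of p "p ^ k"] by auto
  then have "a \<noteq> 0" "Poly_Mapping.keys a \<subseteq> {1..n}"
    using assms(1) by (auto simp: irrelevant_ideal_iff poly_ring_simps in_keys_iff)
  moreover then obtain j where "j \<in> Poly_Mapping.keys a" by fastforce
  ultimately have "j \<in> {1..n}" "0 < Poly_Mapping.lookup a j"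
    by (blast, simp add: in_keys_iff)
  then have "0 < sum (Poly_Mapping.lookup a) {1..n}"
    by (intro sum_pos2[of _ j]) auto
  then show ?case
    using Suc.IH[OF ab(3)] ab(1) by (simp add: lookup_add sum.distrib)
qed simp

text \<open>Pigeonhole: if all \<open>n\<close> exponents of a monomial were below \<open>N\<close>,
  its degree would be below \<open>n * N\<close>. So every monomial of the power is divisible by
  some pure power in \<open>E\<close>.\<close>

lemma irrelevant_power_in_monomial_span:
  fixes p :: "'k::field mpoly"
  assumes E: "E \<subseteq> exponents n" and powers: "\<And>j. j \<in> {1..n} \<Longrightarrow> Poly_Mapping.single j N \<in> E"
    and "0 < n" and p: "p \<in> irrelevant_ideal n"
  shows "p ^ (n * N) \<in> monomial_span n E"
proof -
  have "\<exists>s\<in>E. \<exists>u. m = s + u" if m: "m \<in> Poly_Mapping.keys (p ^ (n * N))" for m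
  proof -
    have "\<exists>j\<in>{1..n}. N \<le> Poly_Mapping.lookup m j"
    proof (rule ccontr)
      assume "\<not> ?thesis"
      then have "sum (Poly_Mapping.lookup m) {1..n} < (\<Sum>j\<in>{1..n}. N)"
        using \<open>0 < n\<close> by (intro sum_strict_mono) (auto simp: not_le)
      then show False using degree_keys_power[OF p m] by simp
    qed
    then obtain j where j: "j \<in> {1..n}" "N \<le> Poly_Mapping.lookup m j" by blast
    then have "\<exists>u. m = Poly_Mapping.single j N + u"
      by (simp add: exponent_dvd_iff lookup_single when_def)
    then show ?thesis using powers j by blast
  qed
  then show ?thesis
    using p by (simp add: in_monomial_span_iff[OF E] irrelevant_ideal_iff poly_ring_power_closed)
qed

text \<open>A polynomial with nonzero constant term is, up to a scalar, $1 - z$ with $z$ nilpotent modulo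
  the ideal, hence a unit there; all other polynomials are nilpotent.\<close>

lemma primary_to_irrelevant_ideal:
  assumes E: "E \<subseteq> exponents n" and powers: "\<And>j. j \<in> {1..n} \<Longrightarrow> Poly_Mapping.single j N \<in> E"
    and "0 < n" and "0 \<notin> E"
  shows "primary_to (poly_ring n) (irrelevant_ideal n) (monomial_span n E :: ('k::field mpoly) set)"
    (is "primary_to ?R ?m ?I")
proof -
  interpret cring ?R by (rule cring_poly_ring)
  interpret ideal ?I ?R by (rule ideal_monomial_span[OF E])
  note nilp = irrelevant_power_in_monomial_span[OF E powers \<open>0 < n\<close>]
  \<comment> \<open>The ideal lies in the irrelevant ideal, since only 0 divides the exponent 0.
    This gives properness as well as one half of the radical equality.\<close>
  have const: "Poly_Mapping.lookup p 0 = 0" if p: "p \<in> ?I" for p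
  proof (rule ccontr)
    assume "Poly_Mapping.lookup p 0 \<noteq> 0"
    then have "0 \<in> Poly_Mapping.keys p" by (simp add: in_keys_iff)
    then obtain s u where "s \<in> E" "0 = s + u"
      using p unfolding in_monomial_span_iff[OF E] by blast
    then show False using \<open>0 \<notin> E\<close> exponent_plus_eq_0_iff by metis
  qed
  have "primaryideal ?I ?R"
  proof (intro primaryideal.intro primaryideal_axioms.intro)
    have "(1 :: 'k mpoly) \<in> carrier ?R" "(1 :: 'k mpoly) \<notin> ?I"
      using const[of 1] by (auto simp: poly_ring_simps lookup_one)
    then show "carrier ?R \<noteq> ?I" by blast
  next
    fix a b :: "'k mpoly"
    assume a: "a \<in> carrier ?R" and b: "b \<in> carrier ?R" and ab: "a \<otimes>\<^bsub>?R\<^esub> b \<in> ?I" and "a \<notin> ?I"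
    have "Poly_Mapping.lookup b 0 = 0"
    proof (rule ccontr)
      assume c: "Poly_Mapping.lookup b 0 \<noteq> 0"
      define e :: "'k mpoly" where "e = Poly_Mapping.single 0 (inverse (Poly_Mapping.lookup b 0))"
      define z where "z = 1 - e * b"
      have e: "e \<in> carrier ?R" by (simp add: e_def poly_ring_simps)
      have eb: "- (e * b) \<in> carrier ?R"
        using poly_ring_mult_closed[OF e b] by (simp add: poly_ring_simps)
      have "z \<in> carrier ?R"
        using poly_ring_add_closed[OF one_closed eb] by (simp add: z_def poly_ring_simps(2-))
      moreover have "Poly_Mapping.lookup z 0 = 0"
        using c by (simp add: z_def e_def lookup_minus lookup_mult_0 lookup_one)
      ultimately have z: "z \<in> ?m" "z \<in> carrier ?R" by (simp_all add: irrelevant_ideal_iff)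
      have "a * (1 - z) = (a * b) * e" by (simp add: z_def ac_simps)
      moreover have "(a * b) * e \<in> ?I"
        using I_r_closed[OF ab e] by (simp add: poly_ring_simps(2))
      ultimately have az: "a * (1 - z) \<in> ?I" by (simp only:)
      \<comment> \<open>\<open>1 - z ^ k\<close> is a multiple of \<open>1 - z\<close>, and
        \<open>a * (1 - z)\<close> is in the ideal.\<close>
      have step: "a * (1 - z ^ k) \<in> ?I" for k
      proof (induction k)
        case 0
        then show ?case using additive_subgroup.zero_closed[OF is_additive_subgroup]
            by (simp add: poly_ring_simps(4))
      next
        case (Suc k)
        have "a * (1 - z ^ Suc k) = a * (1 - z ^ k) + (a * (1 - z)) * z ^ k"
          by (simp add: algebra_simps)
        moreover have "(a * (1 - z)) * z ^ k \<in> ?I"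
          using I_r_closed[OF az poly_ring_power_closed[OF z(2)]] by (simp add: poly_ring_simps(2))
        ultimately show ?case
          using additive_subgroup.a_closed[OF is_additive_subgroup Suc] by (simp add: poly_ring_simps(5))
      qed
      \<comment> \<open>At this exponent the power of \<open>z\<close> lies in the ideal too, and
        the two summands add up to \<open>a\<close>.\<close>
      have "a * (1 - z ^ (n * N)) + a * z ^ (n * N) \<in> ?I"
        using additive_subgroup.a_closed[OF is_additive_subgroup step I_l_closed[OF nilp[OF _ z(1)] a]]
        by (simp add: poly_ring_simps(2-))
      then show False using \<open>a \<notin> ?I\<close> by (simp add: algebra_simps)
    qed
    then show "\<exists>k::nat. b [^]\<^bsub>?R\<^esub> k \<in> ?I"
      using nilp[of b] b by (auto simp: irrelevant_ideal_iff nat_pow_poly_ring)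
  qed (rule ideal_axioms is_cring)+
  moreover have "radical ?R ?I = ?m"
  proof (intro equalityI subsetI)
    fix p assume "p \<in> radical ?R ?I"
    then obtain k :: nat where "p \<in> carrier ?R" "p ^ k \<in> ?I"
      by (auto simp: radical_def nat_pow_poly_ring)
    then show "p \<in> ?m" using const[of "p ^ k"] by (simp add: irrelevant_ideal_iff lookup_power_0)
  next
    fix p assume "p \<in> ?m"
    then show "p \<in> radical ?R ?I"
      using nilp[of p] by (auto simp: radical_def nat_pow_poly_ring irrelevant_ideal_iff)
  qed
  ultimately show ?thesis by (simp add: primary_to_def)
qed

section \<open>The ideals J and I and their powers\<close>

definition core :: "nat \<Rightarrow> nat \<Rightarrow> (nat \<Rightarrow>\<^sub>0 nat) set" where
  "core n k =
    {Poly_Mapping.single 1 (4*k), Poly_Mapping.single 1 (3*k) + Poly_Mapping.single 2 k,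
     Poly_Mapping.single 1 k + Poly_Mapping.single 2 (3*k), Poly_Mapping.single 2 (4*k)} \<union>
    (\<Union>j\<in>{3..n}. {Poly_Mapping.single j (4*k),
       Poly_Mapping.single 1 (2*k) + Poly_Mapping.single j (2*k),
       Poly_Mapping.single 2 (2*k) + Poly_Mapping.single j (2*k)})"

text \<open>The exponent of \<open>x^s y^(k-1-s)\<close> times \<open>x^(2k) y^(2k)\<close>, with
  \<open>x\<close>, \<open>y\<close> the variables 1 and 2. For \<open>s < k\<close> all of these
  have the same degree \<open>5k - 1\<close>.\<close>

definition extra_exponent :: "nat \<Rightarrow> nat \<Rightarrow> (nat \<Rightarrow>\<^sub>0 nat)" where
  "extra_exponent k s = Poly_Mapping.single 1 (2*k + s) + Poly_Mapping.single 2 (3*k - 1 - s)"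

lemma finite_core: "finite (core n k)"
  by (simp add: core_def)

text \<open>The bound is free of \<open>k\<close>, so \<open>k\<close> can be chosen afterwards to
  exceed its powers.\<close>

lemma card_core_le: "card (core n k) \<le> 4 + 3 * n"
proof -
  have c3: "card {a, b, c} \<le> 3" for a b c :: "nat \<Rightarrow>\<^sub>0 nat"
    by (intro card_insert_le_m1) simp_all
  have c4: "card {a, b, c, e} \<le> 4" for a b c e :: "nat \<Rightarrow>\<^sub>0 nat"
    by (intro card_insert_le_m1) simp_all
  let ?U = "\<lambda>j. {Poly_Mapping.single j (4*k),
       Poly_Mapping.single 1 (2*k) + Poly_Mapping.single j (2*k),
       Poly_Mapping.single 2 (2*k) + Poly_Mapping.single j (2*k)}"
  have "card (\<Union>j\<in>{3..n}. ?U j) \<le> (\<Sum>j\<in>{3..n}. card (?U j))" by (rule card_UN_le) simp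
  also have "\<dots> \<le> (\<Sum>j\<in>{3..n}. 3)" by (intro sum_mono c3)
  also have "\<dots> \<le> 3 * n" by simp
  finally show ?thesis
    unfolding core_def by (meson add_mono c4 card_Un_le order_trans)
qed

lemma core_exponents: "2 \<le> n \<Longrightarrow> core n k \<subseteq> exponents n"
  by (auto simp: core_def exponents_def keys_plus_exponent split: if_splits)

lemma extra_exponent_exponents: "2 \<le> n \<Longrightarrow> extra_exponent k s \<in> exponents n"
  by (auto simp: extra_exponent_def exponents_def keys_plus_exponent split: if_splits)


text \<open>For \<open>k = 1\<close> and \<open>p = x^2 y^2\<close> the identities are
  \<open>p^2 = x^3y * xy^3\<close>, \<open>p * x^4 = (x^3y)^2\<close>,
  \<open>p * x^3y = x^4 * xy^3\<close>, \<open>p * z^4 = x^2z^2 * y^2z^2\<close>,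
  \<open>p * x^2z^2 = x^4 * y^2z^2\<close>, and their mirror images under swapping \<open>x\<close>
  and \<open>y\<close>. The mixed generators in \<open>z\<close> are there to absorb
  \<open>p * z^4\<close>.\<close>

lemma core_double:
  assumes "b = Poly_Mapping.single 1 (2*k) + Poly_Mapping.single 2 (2*k) \<or> b \<in> core n k"
  shows "Poly_Mapping.single 1 (2*k) + Poly_Mapping.single 2 (2*k) + b \<in> core n k + core n k"
proof -
  let ?s = "Poly_Mapping.single :: nat \<Rightarrow> nat \<Rightarrow> nat \<Rightarrow>\<^sub>0 nat"
  let ?c = "?s 1 (2*k) + ?s 2 (2*k)"
  have mem: "?s 1 (4*k) \<in> core n k" "?s 1 (3*k) + ?s 2 k \<in> core n k"
    "?s 1 k + ?s 2 (3*k) \<in> core n k" "?s 2 (4*k) \<in> core n k"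
    by (auto simp: core_def)
  have memj: "?s j (4*k) \<in> core n k" "?s 1 (2*k) + ?s j (2*k) \<in> core n k"
    "?s 2 (2*k) + ?s j (2*k) \<in> core n k" if "j \<in> {3..n}" for j
    using that by (auto simp: core_def)
  \<comment> \<open>Splitting every exponent into units of \<open>k\<close> turns each case into a
    rearrangement of summands.\<close>
  have double: "?s i (4*k) = ?s i (2*k) + ?s i (2*k)" "?s i (3*k) = ?s i (2*k) + ?s i k"
    "?s i (2*k) = ?s i k + ?s i k" for i
    by (simp_all flip: single_add) (simp add: mult_2)
  have sum: "?c + b \<in> core n k + core n k"
    if "x \<in> core n k" "y \<in> core n k" "?c + b = x + y" for x y
    using that by auto
  consider "b = ?c" | "b = ?s 1 (4*k)" | "b = ?s 1 (3*k) + ?s 2 k" | "b = ?s 1 k + ?s 2 (3*k)"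
    | "b = ?s 2 (4*k)" | j where "j \<in> {3..n}" "b = ?s j (4*k)"
    | j where "j \<in> {3..n}" "b = ?s 1 (2*k) + ?s j (2*k)"
    | j where "j \<in> {3..n}" "b = ?s 2 (2*k) + ?s j (2*k)"
    using assms by (auto simp: core_def)
  then show ?thesis
  proof cases
    case 1
    show ?thesis by (rule sum[OF mem(2,3)]) (simp add: 1 double add_ac)
  next
    case 2
    show ?thesis by (rule sum[OF mem(2,2)]) (simp add: 2 double add_ac)
  next
    case 3
    show ?thesis by (rule sum[OF mem(1,3)]) (simp add: 3 double add_ac)
  next
    case 4
    show ?thesis by (rule sum[OF mem(2,4)]) (simp add: 4 double add_ac)
  next
    case 5
    show ?thesis by (rule sum[OF mem(3,3)]) (simp add: 5 double add_ac)
  next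
    case 6
    show ?thesis by (rule sum[OF memj(2,3)[OF 6(1)]]) (simp add: 6 double add_ac)
  next
    case 7
    show ?thesis by (rule sum[OF mem(1) memj(3)[OF 7(1)]]) (simp add: 7 double add_ac)
  next
    case 8
    show ?thesis by (rule sum[OF mem(4) memj(2)[OF 8(1)]]) (simp add: 8 double add_ac)
  qed
qed

text \<open>Exhibits the factor \<open>p\<close>; \<open>s < k\<close> keeps the subtraction
  \<open>k - 1 - s\<close> from truncating.\<close>

lemma extra_exponent_eq:
  assumes "s < k"
  shows "extra_exponent k s = Poly_Mapping.single 1 (2*k) + Poly_Mapping.single 2 (2*k)
    + (Poly_Mapping.single 1 s + Poly_Mapping.single 2 (k - 1 - s))"
proof -
  show ?thesis
    using assms
    by (intro poly_mapping_eqI) (auto simp: extra_exponent_def lookup_add lookup_single when_def)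
qed

definition padded_core :: "nat \<Rightarrow> nat \<Rightarrow> (nat \<Rightarrow>\<^sub>0 nat) set" where
  "padded_core n k = core n k \<union> extra_exponent k ` {..<k}"

lemma padded_core_exponents: "2 \<le> n \<Longrightarrow> padded_core n k \<subseteq> exponents n"
  using core_exponents extra_exponent_exponents by (auto simp: padded_core_def)

text \<open>The inclusion of \<open>I^2\<close> in \<open>J^2\<close> on generators. An extra
  generator is a multiple of \<open>p\<close>, so any product involving one is a multiple of
  \<open>p * b\<close> with \<open>b = p\<close> or \<open>b\<close> in the core, as in
  \<open>core_double\<close>; the remaining factors go into \<open>u\<close>.\<close>

lemma padded_core_plus_padded_core:
  assumes "x \<in> padded_core n k" "y \<in> padded_core n k"
  shows "\<exists>z\<in>core n k + core n k. \<exists>u. x + y = z + u"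
proof -
  let ?c = "Poly_Mapping.single 1 (2*k) + Poly_Mapping.single 2 (2*k) :: nat \<Rightarrow>\<^sub>0 nat"
  have split: "x \<in> core n k \<or> (\<exists>u. x = ?c + u)" if "x \<in> padded_core n k" for x
    using that extra_exponent_eq[of _ k] by (auto simp: padded_core_def)
  have dbl: "\<exists>z\<in>core n k + core n k. \<exists>u. x + y = z + u"
    if "x = ?c + v" "b = ?c \<or> b \<in> core n k" "y = b + w" for x y b v w
    using core_double[OF that(2)] that(1,3)
    by (intro bexI[of _ "?c + b"] exI[of _ "v + w"]) (auto simp: ac_simps)
  consider "x \<in> core n k" "y \<in> core n k" | v where "x \<in> core n k" "y = ?c + v"
    | v where "x = ?c + v" "y \<in> core n k" | v w where "x = ?c + v" "y = ?c + w"
    using split[OF assms(1)] split[OF assms(2)] by blast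
  then show ?thesis
  proof cases
    case 1
    then show ?thesis by (intro bexI[of _ "x + y"] exI[of _ 0]) auto
  next
    case 2
    then show ?thesis using dbl[of y v x x 0] by (simp add: add.commute)
  next
    case 3
    then show ?thesis using dbl[of x v y y 0] by simp
  next
    case 4
    then show ?thesis using dbl[of x v ?c y w] by blast
  qed
qed

lemma ideal_power_simps:
  "ideal_power (R :: ('a, 'b) ring_scheme) I 0 = carrier R"
  "ideal_power R I (Suc i) = ideal_prod R (ideal_power R I i) I"
  by (simp_all add: ideal_power_def ideals_set_def nat_pow_def)

text \<open>From \<open>I^2 = IJ = J^2\<close> all powers from the second on agree; the form
  \<open>i + 2\<close> lets the induction start at the square.\<close>

lemma ideal_power_padded_core:
  assumes n: "2 \<le> n"
  shows "ideal_power (poly_ring n) (monomial_span n (padded_core n k)) (i + 2)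
    = (ideal_power (poly_ring n) (monomial_span n (core n k)) (i + 2) :: ('k::field mpoly) set)"
proof -
  let ?R = "poly_ring n :: 'k mpoly ring"
  let ?I = "monomial_span n (padded_core n k) :: 'k mpoly set"
  let ?J = "monomial_span n (core n k) :: 'k mpoly set"
  note F = padded_core_exponents[OF n, of k] and C = core_exponents[OF n, of k]
  have sub: "core n k \<subseteq> padded_core n k" by (simp add: padded_core_def)
  \<comment> \<open>Any two ideals between \<open>J\<close> and \<open>I\<close> have product
    \<open>J^2\<close>. The base case uses this for \<open>I\<close> and \<open>I\<close>, the
    induction step for \<open>J\<close> and \<open>I\<close>.\<close>
  have squares: "ideal_prod ?R (monomial_span n E) (monomial_span n G) = ideal_prod ?R ?J ?J"
    if "core n k \<subseteq> E" "E \<subseteq> padded_core n k" "core n k \<subseteq> G" "G \<subseteq> padded_core n k" for E G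
  proof -
    have EG: "E \<subseteq> exponents n" "G \<subseteq> exponents n" using that F by auto
    have "core n k + core n k \<subseteq> E + G" using that by (intro set_plus_mono2)
    then have "(monomial_span n (core n k + core n k) :: 'k mpoly set) \<subseteq> monomial_span n (E + G)"
      using EG C by (intro monomial_span_mono set_plus_exponents) (auto intro!: bexI exI[of _ 0])
    moreover have "(monomial_span n (E + G) :: 'k mpoly set) \<subseteq> monomial_span n (core n k + core n k)"
      using EG C that
      by (intro monomial_span_mono set_plus_exponents)
        (auto elim!: set_plus_elim intro!: padded_core_plus_padded_core)
    ultimately show ?thesis using EG C by (simp add: ideal_prod_monomial_span)
  qed
  interpret cring ?R by (rule cring_poly_ring)
  have I: "ideal ?I ?R" and J: "ideal ?J ?R"
    using F C by (auto intro: ideal_monomial_span)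
  have JJ: "ideal (ideal_power ?R ?J i) ?R" for i
    using ideal_power_monomial_span[OF C] by (metis ideal_monomial_span)
  have one: "ideal_prod ?R (carrier ?R) K = K" if "ideal K ?R" for K
    using that by (metis ideal_prod_commute ideal_prod_one oneideal)
  show ?thesis
  proof (induction i)
    case 0
    show ?case
      using squares[OF sub order_refl sub order_refl]
      by (simp add: ideal_power_simps numeral_2_eq_2 one I J)
  next
    case (Suc i)
    \<comment> \<open>After the induction hypothesis one factor \<open>J\<close> is split off, to be
      paired with the last factor \<open>I\<close>.\<close>
    have "ideal_power ?R ?I (Suc i + 2)
        = ideal_prod ?R (ideal_prod ?R (ideal_power ?R ?J (Suc i)) ?J) ?I"
      using Suc by (simp add: ideal_power_simps)
    also have "\<dots> = ideal_prod ?R (ideal_power ?R ?J (Suc i)) (ideal_prod ?R ?J ?J)"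
      using squares[OF order_refl sub sub order_refl] by (simp add: ideal_prod_assoc I J JJ)
    also have "\<dots> = ideal_prod ?R (ideal_prod ?R (ideal_power ?R ?J (Suc i)) ?J) ?J"
      by (rule ideal_prod_assoc[OF JJ J J, symmetric])
    also have "\<dots> = ideal_power ?R ?J (Suc i + 2)"
      by (simp add: ideal_power_simps)
    finally show ?case .
  qed
qed

section \<open>Counting minimal generators\<close>

lemma card_min_monomial_gens_le:
  assumes "E \<subseteq> exponents n" "finite E"
  shows "card (min_monomial_gens n (monomial_span n E :: ('k::field mpoly) set)) \<le> card E"
proof -
  let ?M = "{m \<in> E. \<forall>s\<in>E. \<forall>u. m = s + u \<longrightarrow> u = 0}"
  have "card (monomial_of ` ?M :: 'k mpoly set) \<le> card ?M"
    using assms by (intro card_image_le) simp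
  also have "\<dots> \<le> card E" using assms by (intro card_mono) auto
  finally show ?thesis using assms by (simp add: min_monomial_gens_monomial_span)
qed

text \<open>In an extra exponent both coordinates are below \<open>3k\<close> and no third variable
  occurs, so no core element divides it. Among extra exponents, raising the first coordinate lowers
  the second, so none divides another.\<close>

lemma extra_exponent_minimal:
  assumes "s < k" "e \<in> padded_core n k" "extra_exponent k s = e + u"
  shows "u = 0"
proof -
  have le: "Poly_Mapping.lookup e i \<le> Poly_Mapping.lookup (extra_exponent k s) i" for i
    using assms(3) by (simp add: lookup_add)
  have "e \<notin> core n k"
  proof
    assume "e \<in> core n k"
    then consider "e = Poly_Mapping.single 1 (4*k)"
      | "e = Poly_Mapping.single 1 (3*k) + Poly_Mapping.single 2 k"
      | "e = Poly_Mapping.single 1 k + Poly_Mapping.single 2 (3*k)"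
      | "e = Poly_Mapping.single 2 (4*k)"
      | j where "3 \<le> j" "0 < Poly_Mapping.lookup e j"
      using assms(1) by (fastforce simp: core_def lookup_add)
    then show False
    proof cases
      case 5
      then show False
        using le[of j] by (simp add: extra_exponent_def lookup_add lookup_single when_def)
    qed (use le[of 1] le[of 2] assms(1)
        in \<open>simp_all add: extra_exponent_def lookup_add lookup_single when_def\<close>)
  qed
  then obtain t where t: "t < k" "e = extra_exponent k t" using assms(2)
    by (auto simp: padded_core_def)
  have "t = s"
    using le[of 1] le[of 2] assms(1) t by (simp add: extra_exponent_def lookup_add lookup_single)
  then show ?thesis using assms(3) t by simp
qed

lemma card_min_monomial_gens_padded_core_ge:
  assumes n: "2 \<le> n"
  shows "k \<le> card (min_monomial_gens n (monomial_span n (padded_core n k) :: ('k::field mpoly) set))"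
proof -
  have inj: "inj_on (\<lambda>s. monomial_of (extra_exponent k s) :: 'k mpoly) {..<k}"
  proof (rule inj_onI)
    fix s t
    assume "(monomial_of (extra_exponent k s) :: 'k mpoly) = monomial_of (extra_exponent k t)"
    then have "Poly_Mapping.lookup (extra_exponent k s) 1 = Poly_Mapping.lookup (extra_exponent k t) 1"
      by simp
    then show "s = t" by (simp add: extra_exponent_def lookup_add lookup_single)
  qed
  let ?G = "min_monomial_gens n (monomial_span n (padded_core n k)) :: 'k mpoly set"
  note G = min_monomial_gens_monomial_span[OF padded_core_exponents[OF n]]
  have "monomial_of (extra_exponent k s) \<in> ?G" if "s < k" for s
  proof -
    have "extra_exponent k s \<in> padded_core n k" using that by (simp add: padded_core_def)
    then show ?thesis unfolding G using extra_exponent_minimal[OF that] by blast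
  qed
  then have "(\<lambda>s. monomial_of (extra_exponent k s)) ` {..<k} \<subseteq> ?G" by blast
  \<comment> \<open>Needed because \<open>card\<close> of an infinite set is 0.\<close>
  moreover have "finite ?G" unfolding G by (simp add: padded_core_def finite_core)
  ultimately have "card {..<k} \<le> card ?G" by (intro card_inj_on_le[OF inj])
  then show ?thesis by simp
qed

theorem mainTheorem1:
  fixes n d :: nat
  assumes "2 \<le> n" and "2 \<le> d"
  shows "\<exists>I :: ('k::field mpoly) set.
           monomial_ideal n I \<and>
           primary_to (poly_ring n) (irrelevant_ideal n) I \<and>
           (\<forall>i. 2 \<le> i \<and> i \<le> d \<longrightarrow>
              card (min_monomial_gens n (ideal_power (poly_ring n) I i))
                < card (min_monomial_gens n I))"
proof -
  \<comment> \<open>One more than a bound for the number of generators of \<open>J^i\<close> for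
    every \<open>i \<le> d\<close>.\<close>
  define k where "k = (4 + 3 * n) ^ d + 1"
  let ?I = "monomial_span n (padded_core n k) :: 'k mpoly set"
  let ?J = "monomial_span n (core n k) :: 'k mpoly set"
  have "0 < k" by (simp add: k_def)
  note F = padded_core_exponents[OF assms(1), of k] and C = core_exponents[OF assms(1), of k]
  have "Poly_Mapping.single j (4*k) \<in> padded_core n k" if "j \<in> {1..n}" for j
    using that by (cases "j = 1"; cases "j = 2") (auto simp: padded_core_def core_def)
  moreover have "0 \<notin> padded_core n k"
  proof
    assume "0 \<in> padded_core n k"
    \<comment> \<open>The exponent 0 divides everything, so minimality would force this extra
      exponent to vanish, although its first coordinate is \<open>2k\<close>.\<close>
    then have "extra_exponent k 0 = 0"
      using extra_exponent_minimal[of 0 k 0 n "extra_exponent k 0"] \<open>0 < k\<close> by simp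
    then have "Poly_Mapping.lookup (extra_exponent k 0) 1 = 0" by simp
    then show False
      using \<open>0 < k\<close> by (simp add: extra_exponent_def lookup_add lookup_single)
  qed
  ultimately have "primary_to (poly_ring n) (irrelevant_ideal n) ?I"
    using F assms(1) by (intro primary_to_irrelevant_ideal[where N = "4*k"]) auto
  moreover have "card (min_monomial_gens n (ideal_power (poly_ring n) ?I i))
      < card (min_monomial_gens n ?I)" if i: "2 \<le> i" "i \<le> d" for i
  proof -
    let ?E = "((+) (core n k) ^^ i) {0}"
    have "ideal_power (poly_ring n) ?I i = ideal_power (poly_ring n) ?J i"
      using ideal_power_padded_core[OF assms(1), of k "i - 2"]
      by (simp only: le_add_diff_inverse2[OF i(1)])
    also have "\<dots> = monomial_span n ?E"
      by (rule conjunct2[OF ideal_power_monomial_span[OF C]])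
    finally have eq: "ideal_power (poly_ring n) ?I i = monomial_span n ?E" .
    have E: "?E \<subseteq> exponents n"
      by (rule conjunct1[OF ideal_power_monomial_span[OF C]])
    note card_E = finite_card_iterated_set_plus[OF finite_core]
    from E conjunct1[OF card_E] have "card (min_monomial_gens n (ideal_power (poly_ring n) ?I i)) \<le> card ?E"
      unfolding eq by (rule card_min_monomial_gens_le)
    also have "\<dots> \<le> card (core n k) ^ i"
      by (rule conjunct2[OF card_E])
    also have "\<dots> \<le> (4 + 3 * n) ^ i" by (rule power_mono[OF card_core_le]) simp
    also have "\<dots> \<le> (4 + 3 * n) ^ d" using i by (intro power_increasing) auto
    also have "\<dots> < k" by (simp add: k_def)
    also have "k \<le> card (min_monomial_gens n ?I)"
      by (rule card_min_monomial_gens_padded_core_ge[OF assms(1)])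
    finally show ?thesis .
  qed
  ultimately show ?thesis using monomial_ideal_monomial_span[OF F] by blast
qed

end
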